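(* There is a degree-preserving bijection between $\mathcal W_0$ and the disjoint union $\mathcal W_0^*\cup\mathcal B_2$. There is also a degree-preserving bijection between $\mathcal W_1$ and the disjoint union $\mathcal W_1^*\cup\mathcal B_3\cup(\mathcal B_2)^2$. For a pair of trees, the degree distribution is the union of their degree distributions.
   Context: All maps are planar, connected, considered up to orientation-preserving homeomorphism, and bipartite: vertices are black or white and each edge joins a black and a white vertex. Maps may carry half-edges attached to single vertices and lying in the infinite face. A half-edge at a white vertex is a leaf; one at a black vertex is a bud. Maps are rooted at a half-edge. Degrees count edges and half-edges. Degree-preserving means preserving the pair of multisets of degrees of white and of black vertices. A tree is such a map with a single face. Its charge is the number of leaves minus the number of buds, not counting the root half-edge; the total charge counts it. For an edge $e$ of a tree $T$, cutting $e$ into a leaf at its white end and a bud at its black end yields $T_e^\bullet$ (containing the black end) and $T_e^\circ$ (containing the white end), each rooted at its new half-edge. The lower subtree at $e$ is the one not containing the root. A blossom tree is a tree such that, for every edge $e$: the lower subtree has charge $\ge0$ if it is $T_e^\circ$, and $\le1$ if it is $T_e^\bullet$. For a tree of total charge $k\ge1$, go counterclockwise around the tree and repeatedly match a bud immediately followed (among still unmatched half-edges in the cyclic order) by a leaf. The $k$ leaves left unmatched are single. A tree rooted at a leaf is balanced if its root is single. $\mathcal W_i$ is the set of blossom trees of charge $i$ rooted at a leaf. $\mathcal B_i$ is the set of blossom trees of charge $i$ rooted at a bud. For $i\ge0$, $\mathcal W_i^*$ is the subset of balanced trees in $\mathcal W_i$. *)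

theory Defs
  imports Main "HOL-Library.Multiset"
begin

datatype colour = White | Black

datatype half_edge = Leaf | Bud

text \<open>
  A plane tree (a planar map with a single face) rooted at a half-edge, taken up to
  orientation-preserving homeomorphism, is an ordered tree. In \<open>Vertex c xs\<close>, the vertex of
  colour \<open>c\<close> is the one carrying the root half-edge, and \<open>xs\<close> lists what else is incident to it,
  in counterclockwise order starting after the root half-edge: \<open>None\<close> is a half-edge, and
  \<open>Some s\<close> is an edge \<open>e\<close>, where \<open>s\<close> is the lower subtree at \<open>e\<close>, that is, the component not
  containing the root once \<open>e\<close> is cut, rooted at the half-edge created by the cut.
\<close>

datatype tree = Vertex (colour: colour) (incident: "tree option list")

fun bipartite :: "tree \<Rightarrow> bool" where
  "bipartite (Vertex c xs) \<longleftrightarrow> (\<forall>s. Some s \<in> set xs \<longrightarrow> colour s \<noteq> c \<and> bipartite s)"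

fun half_edge_at :: "colour \<Rightarrow> half_edge" where
  "half_edge_at White = Leaf"
| "half_edge_at Black = Bud"

text \<open>The half-edges other than the root, in counterclockwise order around the tree.\<close>

fun half_edges :: "tree \<Rightarrow> half_edge list" where
  "half_edges (Vertex c xs) =
    concat (map (\<lambda>x. case x of None \<Rightarrow> [half_edge_at c] | Some s \<Rightarrow> half_edges s) xs)"

definition contour :: "tree \<Rightarrow> half_edge list" where
  "contour t = half_edge_at (colour t) # half_edges t"

definition charge :: "tree \<Rightarrow> int" where
  "charge t = int (count_list (half_edges t) Leaf) - int (count_list (half_edges t) Bud)"

text \<open>
  Degrees of the vertices of a given colour. The summand 1 in \<open>1 + length xs\<close> accounts for the
  root half-edge or, below the root vertex, for the edge towards the root.
\<close>

fun degrees :: "colour \<Rightarrow> tree \<Rightarrow> nat multiset" where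
  "degrees d (Vertex c xs) =
    (if c = d then {#1 + length xs#} else {#}) +
    (\<Sum>x\<leftarrow>xs. case x of None \<Rightarrow> {#} | Some s \<Rightarrow> degrees d s)"

definition degree_distribution :: "tree \<Rightarrow> nat multiset \<times> nat multiset" where
  "degree_distribution t = (degrees White t, degrees Black t)"

definition degree_distribution_pair :: "tree \<times> tree \<Rightarrow> nat multiset \<times> nat multiset" where
  "degree_distribution_pair = (\<lambda>(s, t).
    (degrees White s + degrees White t, degrees Black s + degrees Black t))"

fun lower_subtrees :: "tree \<Rightarrow> tree set" where
  "lower_subtrees (Vertex c xs) =
    (\<Union>x\<in>set xs. case x of None \<Rightarrow> {} | Some s \<Rightarrow> insert s (lower_subtrees s))"

text \<open>
  A lower subtree with white root vertex contains the white end of the cut edge, one with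
  black root vertex contains the black end.
\<close>

definition blossom_tree :: "tree \<Rightarrow> bool" where
  "blossom_tree t \<longleftrightarrow> bipartite t \<and>
    (\<forall>s\<in>lower_subtrees t.
      (colour s = White \<longrightarrow> charge s \<ge> 0) \<and> (colour s = Black \<longrightarrow> charge s \<le> 1))"

text \<open>
  One step of the matching procedure, on the list of still unmatched half-edges, which is to be
  read cyclically and in which each half-edge carries its position around the tree as a label.
\<close>

inductive match_step ::
  "(nat \<times> half_edge) list \<Rightarrow> (nat \<times> half_edge) list \<Rightarrow> bool" where
  "match_step (us @ (i, Bud) # (j, Leaf) # vs) (us @ vs)"
| "match_step ((j, Leaf) # us @ [(i, Bud)]) us"

text \<open>
  The set of half-edges left at the end does not depend on the order in which pairs are
  matched. The root half-edge has label 0.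
\<close>

definition balanced :: "tree \<Rightarrow> bool" where
  "balanced t \<longleftrightarrow> colour t = White \<and>
    (\<exists>us. match_step\<^sup>*\<^sup>* (enumerate 0 (contour t)) us \<and> \<not> (\<exists>vs. match_step us vs) \<and>
      (0, Leaf) \<in> set us)"

definition W :: "int \<Rightarrow> tree set" where
  "W i = {t. blossom_tree t \<and> colour t = White \<and> charge t = i}"

definition B :: "int \<Rightarrow> tree set" where
  "B i = {t. blossom_tree t \<and> colour t = Black \<and> charge t = i}"

definition W_star :: "int \<Rightarrow> tree set" where
  "W_star i = {t \<in> W i. balanced t}"

end

theory Submission
  imports Defs
begin

text \<open>
  All the sets involved have finitely many elements of a given degree distribution, so it suffices
  to count. For the tour of an unrooted tree let the peak at a dart be the maximal excess of leaves
  over buds in an initial part of the tour starting there; for the peak of a rooted tree, the root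
  half-edge is left out. A tree rooted at a leaf is balanced iff its peak equals its charge. Passing
  over a bud raises the peak by 1, passing over a matched leaf lowers it by 1, and edges and single
  leaves do not change it.

  For total charge 1, rerooting preserves the blossom condition. The tour crosses each level of the
  peak equally often in both directions, hence unbalanced trees of \<open>W 0\<close> with peak \<open>m\<close> are as
  numerous as trees of \<open>B 2\<close> with peak \<open>m + 1\<close>.

  For total charge 2, sum the decrease of the peak at each step over all darts satisfying the blossom
  condition. This counts the unbalanced trees of \<open>W 1\<close> minus the trees of \<open>B 3\<close>. The sum telescopes,
  except where the tour crosses an edge that splits the tree into \<open>s\<close> in \<open>B 2\<close> and \<open>t\<close> in \<open>W 0\<close>. If
  \<open>t\<close> is balanced, these crossings contribute nothing. Otherwise replace \<open>t\<close> by a tree \<open>s'\<close> of \<open>B 2\<close>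
  as above: they contribute 2, 1 or 0 according to whether the peak of \<open>s\<close> is less than, equal to or
  greater than that of \<open>s'\<close>. Exchanging \<open>s\<close> and \<open>s'\<close>, the contribution is 1 on average, so it is the
  number of elements of \<open>B 2 \<times> B 2\<close> in total.
\<close>

section \<open>Excess and peak of words of half-edges\<close>

definition excess :: "half_edge list \<Rightarrow> int" where
  "excess w = int (count_list w Leaf) - int (count_list w Bud)"

lemma excess_simps [simp]:
  "excess [] = 0"
  "excess (Leaf # w) = excess w + 1"
  "excess (Bud # w) = excess w - 1"
  "excess (v @ w) = excess v + excess w"
  by (auto simp: excess_def)

lemma charge_eq_excess: "charge t = excess (half_edges t)"
  by (simp add: charge_def excess_def)

fun peak :: "half_edge list \<Rightarrow> int" where
  "peak [] = 0"
| "peak (h # w) = max 0 ((if h = Leaf then 1 else - 1) + peak w)"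

lemma peak_nonneg [simp]: "0 \<le> peak w"
  by (cases w) auto

lemma peak_append: "peak (v @ w) = max (peak v) (excess v + peak w)"
proof (induction v)
  case (Cons h v)
  moreover have "0 \<le> peak v" by simp
  ultimately show ?case by (cases h) (auto simp: max_def simp del: peak_nonneg)
qed simp

lemma excess_le_peak: "excess w \<le> peak w"
proof (induction w)
  case (Cons h w)
  then show ?case by (cases h) auto
qed simp

text \<open>A prefix ending between the two has a smaller excess than the one before the bud, and
  the whole pair has excess 0.\<close>

lemma peak_remove_Bud_Leaf: "peak (v @ Bud # Leaf # w) = peak (v @ w)"
  by (simp add: peak_append)

lemma Bud_Leaf_adjacent:
  assumes "Bud \<in> set w" "w = [] \<or> last w \<noteq> Bud"
  shows "\<exists>u v. w = u @ Bud # Leaf # v"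
proof -
  obtain u v where w: "w = u @ Bud # v" "Bud \<notin> set v"
    using split_list_last[OF assms(1)] by blast
  moreover obtain h v' where "v = h # v'"
    using w assms(2) by (cases v) auto
  ultimately show ?thesis by (cases h) auto
qed

lemma peak_eq_excess_if_no_Bud: "Bud \<notin> set w \<Longrightarrow> peak w = excess w \<and> 0 \<le> excess w"
proof (induction w)
  case (Cons h w)
  then show ?case by (cases h) auto
qed simp

section \<open>The matching procedure and balanced trees\<close>

lemma length_match_step: "match_step us vs \<Longrightarrow> length vs < length us"
  by (induction rule: match_step.induct) auto

lemma match_terminates: "\<exists>vs. match_step\<^sup>*\<^sup>* us vs \<and> \<not> (\<exists>ws. match_step vs ws)"
proof (induction us rule: length_induct)
  case (1 us)
  show ?case
  proof (cases "\<exists>vs. match_step us vs")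
    case True
    then obtain vs where "match_step us vs" by blast
    with 1 length_match_step show ?thesis
      by (meson converse_rtranclp_into_rtranclp)
  qed auto
qed

lemma match_step_subset: "match_step us vs \<Longrightarrow> set vs \<subseteq> set us"
  by (induction rule: match_step.induct) auto

text \<open>Deleting an adjacent pair of a bud and a leaf changes neither the excess nor the peak, so the
  comparison of the two is an invariant as long as the root leaf is still there.\<close>

lemma match_step_root:
  assumes "match_step ((0, Leaf) # us) vs" "0 \<notin> fst ` set us"
  shows "0 \<notin> fst ` set vs \<and> excess (map snd us) < peak (map snd us) \<or>
    (\<exists>us'. vs = (0, Leaf) # us' \<and> 0 \<notin> fst ` set us' \<and>
      peak (map snd us') = peak (map snd us) \<and> excess (map snd us') = excess (map snd us))"
  using assms(1)
proof cases
  case (1 xs i j ys)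
  then obtain xs' where "xs = (0, Leaf) # xs'" by (cases xs) auto
  with 1 have "us = xs' @ (i, Bud) # (j, Leaf) # ys" "vs = (0, Leaf) # xs' @ ys" by auto
  with assms(2) show ?thesis
    by (auto simp: peak_remove_Bud_Leaf)
next
  case (2 i)
  \<comment> \<open>The root leaf is matched with the final bud of \<open>us\<close>, and removing
    this bud gives \<open>vs\<close>. So the excess of \<open>us\<close> is less than that of
    \<open>vs\<close>, hence less than the peak of \<open>us\<close>.\<close>
  have "excess (map snd vs) \<le> peak (map snd vs)" by (rule excess_le_peak)
  with 2 assms(2) show ?thesis
    by (auto simp: peak_append)
qed

lemma match_steps_root:
  assumes "match_step\<^sup>*\<^sup>* ((0, Leaf) # us) vs" "0 \<notin> fst ` set us"
  shows "0 \<notin> fst ` set vs \<and> excess (map snd us) < peak (map snd us) \<or>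
    (\<exists>us'. vs = (0, Leaf) # us' \<and> 0 \<notin> fst ` set us' \<and>
      peak (map snd us') = peak (map snd us) \<and> excess (map snd us') = excess (map snd us))"
  using assms(1)
proof (induction rule: rtranclp_induct)
  case base
  then show ?case using assms(2) by simp
next
  case (step vs ws)
  from step.IH show ?case
  proof (elim disjE exE conjE)
    assume "0 \<notin> fst ` set vs" "excess (map snd us) < peak (map snd us)"
    then show ?case using match_step_subset[OF step.hyps(2)] by blast
  next
    fix us' assume us': "vs = (0, Leaf) # us'" "0 \<notin> fst ` set us'"
      "peak (map snd us') = peak (map snd us)" "excess (map snd us') = excess (map snd us)"
    then show ?case using match_step_root[of us' ws] step.hyps(2) by auto
  qed
qed

text \<open>The hypothesis forces a bud in \<open>us\<close>. Either the last bud is followed by a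
  leaf, or it ends the word and is cyclically followed by the root leaf.\<close>

lemma match_step_exists:
  assumes "excess (map snd us) < peak (map snd us)"
  shows "\<exists>vs. match_step ((0, Leaf) # us) vs"
proof -
  have Bud: "Bud \<in> set (map snd us)"
    using assms peak_eq_excess_if_no_Bud[of "map snd us"] by (rule_tac ccontr) simp
  show ?thesis
  proof (cases "us = [] \<or> last (map snd us) \<noteq> Bud")
    case True
    then obtain u v where "map snd us = u @ Bud # Leaf # v"
      using Bud_Leaf_adjacent[OF Bud] by auto
    then obtain us1 us2 i j where "us = us1 @ (i, Bud) # (j, Leaf) # us2"
      by (auto simp: map_eq_append_conv map_eq_Cons_conv)
    then show ?thesis using match_step.intros(1)[of "(0, Leaf) # us1" i j us2] by auto
  next
    case False
    then obtain us' i where "us = us' @ [(i, Bud)]"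
      by (cases us rule: rev_cases) auto
    then show ?thesis using match_step.intros(2) by blast
  qed
qed

text \<open>A final configuration that still contains the root leaf must have equal peak and excess,
  as otherwise a further step exists. Conversely, the root leaf can only disappear if the excess is
  below the peak.\<close>

lemma balanced_iff_peak:
  assumes "colour t = White"
  shows "balanced t \<longleftrightarrow> peak (half_edges t) \<le> charge t"
proof -
  define us where "us = enumerate 1 (half_edges t)"
  have start: "enumerate 0 (contour t) = (0, Leaf) # us"
    by (simp add: contour_def assms us_def)
  have us: "0 \<notin> fst ` set us" "map snd us = half_edges t"
    by (auto simp: us_def in_set_enumerate_eq)
  obtain vs where vs: "match_step\<^sup>*\<^sup>* ((0, Leaf) # us) vs" "\<not> (\<exists>ws. match_step vs ws)"
    using match_terminates by blast
  have stuck: "excess (half_edges t) = peak (half_edges t)"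
    if vs: "match_step\<^sup>*\<^sup>* ((0, Leaf) # us) vs" "\<not> (\<exists>ws. match_step vs ws)" "(0, Leaf) \<in> set vs" for vs
  proof -
    obtain us' where "vs = (0, Leaf) # us'" "peak (map snd us') = peak (map snd us)"
      "excess (map snd us') = excess (map snd us)"
      using match_steps_root[OF vs(1) us(1)] vs(3) by force
    then show ?thesis
      using match_step_exists[of us'] vs(2) excess_le_peak[of "half_edges t"] us(2) by force
  qed
  show ?thesis
  proof
    assume "balanced t"
    then show "peak (half_edges t) \<le> charge t"
      using stuck unfolding balanced_def start charge_eq_excess by fastforce
  next
    assume "peak (half_edges t) \<le> charge t"
    then have "(0, Leaf) \<in> set vs"
      using match_steps_root[OF vs(1) us(1)] us(2) by (auto simp: charge_eq_excess)
    then show "balanced t" using vs assms unfolding balanced_def start by blast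
  qed
qed

section \<open>Blossom condition, darts and the face permutation\<close>

lemma half_edges_Vertex_simps [simp]:
  "half_edges (Vertex c []) = []"
  "half_edges (Vertex c (None # xs)) = half_edge_at c # half_edges (Vertex c xs)"
  "half_edges (Vertex c (Some s # xs)) = half_edges s @ half_edges (Vertex c xs)"
  "half_edges (Vertex c (xs @ ys)) = half_edges (Vertex c xs) @ half_edges (Vertex c ys)"
  by auto

declare half_edges.simps [simp del]

lemma charge_Vertex_simps [simp]:
  "charge (Vertex c []) = 0"
  "charge (Vertex White (None # xs)) = charge (Vertex White xs) + 1"
  "charge (Vertex Black (None # xs)) = charge (Vertex Black xs) - 1"
  "charge (Vertex c (Some s # xs)) = charge s + charge (Vertex c xs)"
  "charge (Vertex c (xs @ ys)) = charge (Vertex c xs) + charge (Vertex c ys)"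
  by (auto simp: charge_eq_excess)

definition admissible :: "tree \<Rightarrow> bool" where
  "admissible s \<longleftrightarrow> (colour s = White \<longrightarrow> charge s \<ge> 0) \<and> (colour s = Black \<longrightarrow> charge s \<le> 1)"

lemma blossom_tree_simps [simp]:
  "blossom_tree (Vertex c [])"
  "blossom_tree (Vertex c (None # xs)) \<longleftrightarrow> blossom_tree (Vertex c xs)"
  "blossom_tree (Vertex c (Some s # xs)) \<longleftrightarrow>
    colour s \<noteq> c \<and> admissible s \<and> blossom_tree s \<and> blossom_tree (Vertex c xs)"
  "blossom_tree (Vertex c (xs @ ys)) \<longleftrightarrow> blossom_tree (Vertex c xs) \<and> blossom_tree (Vertex c ys)"
  unfolding blossom_tree_def admissible_def
  by (auto simp: ball_Un split: option.splits)

text \<open>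
  From here on a tree \<open>Vertex c (x # xs)\<close> also stands for an unrooted tree with a distinguished dart
  \<open>x\<close>, which may be a half-edge or an edge seen from one of its ends. A tree \<open>Vertex c xs\<close> rooted at
  a half-edge becomes \<open>Vertex c (None # xs)\<close>. The function \<open>next_dart\<close> is the face permutation.
\<close>

fun next_dart :: "tree \<Rightarrow> tree" where
  "next_dart (Vertex c []) = Vertex c []"
| "next_dart (Vertex c (None # xs)) = Vertex c (xs @ [None])"
| "next_dart (Vertex c (Some (Vertex d ys) # xs)) = Vertex d (ys @ [Some (Vertex c xs)])"

text \<open>The last entry of the resulting list shows how to undo the move.\<close>

lemma inj_next_dart: "inj next_dart"
proof (rule injI)
  fix s t assume "next_dart s = next_dart t"
  then show "s = t"
    by (cases s rule: next_dart.cases; cases t rule: next_dart.cases) auto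
qed

text \<open>There is no summand 1 at the top vertex: the distinguished dart is itself an entry of
  the list.\<close>

fun dart_degrees :: "colour \<Rightarrow> tree \<Rightarrow> nat multiset" where
  "dart_degrees d (Vertex c xs) =
    (if c = d then {#length xs#} else {#}) +
    (\<Sum>x\<leftarrow>xs. case x of None \<Rightarrow> {#} | Some s \<Rightarrow> degrees d s)"

definition dart_distribution :: "tree \<Rightarrow> nat multiset \<times> nat multiset" where
  "dart_distribution t = (dart_degrees White t, dart_degrees Black t)"

lemma dart_distribution_next_dart [simp]:
  "dart_distribution (next_dart t) = dart_distribution t"
  by (cases t rule: next_dart.cases) (auto simp: dart_distribution_def)

lemma dart_distribution_None [simp]:
  "dart_distribution (Vertex c (None # xs)) = degree_distribution (Vertex c xs)"
  "dart_distribution (Vertex c (xs @ [None])) = degree_distribution (Vertex c xs)"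
  by (simp_all add: dart_distribution_def degree_distribution_def)

lemma dart_distribution_Some [simp]:
  "dart_distribution (Vertex c (xs @ [Some s])) = degree_distribution_pair (Vertex c xs, s)"
  "dart_distribution (Vertex c (Some s # xs)) = degree_distribution_pair (Vertex c xs, s)"
  by (auto simp: dart_distribution_def degree_distribution_pair_def)

lemma degree_distribution_pair_commute:
  "degree_distribution_pair (s, t) = degree_distribution_pair (t, s)"
  by (simp add: degree_distribution_pair_def add.commute)

lemma degree_distribution_pair_cong:
  "degree_distribution s = degree_distribution s' \<Longrightarrow> degree_distribution t = degree_distribution t' \<Longrightarrow>
    degree_distribution_pair (s, t) = degree_distribution_pair (s', t')"
  by (simp add: degree_distribution_pair_def degree_distribution_def)

section \<open>Finiteness of the degree fibres, and bijections by counting\<close>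

fun total_degree :: "tree \<Rightarrow> nat" where
  "total_degree (Vertex c xs) =
    1 + length xs + (\<Sum>x\<leftarrow>xs. case x of None \<Rightarrow> 0 | Some s \<Rightarrow> total_degree s)"

lemma sum_mset_sum_list: "\<Sum>\<^sub># (\<Sum>x\<leftarrow>xs. f x) = (\<Sum>x\<leftarrow>xs. \<Sum>\<^sub># (f x))"
  by (induction xs) auto

lemma total_degree_eq: "total_degree t = \<Sum>\<^sub># (degrees White t) + \<Sum>\<^sub># (degrees Black t)"
proof (induction t)
  case (Vertex c xs)
  have *: "(case x of None \<Rightarrow> 0 | Some s \<Rightarrow> total_degree s) =
      \<Sum>\<^sub># (case x of None \<Rightarrow> {#} | Some s \<Rightarrow> degrees White s) +
      \<Sum>\<^sub># (case x of None \<Rightarrow> {#} | Some s \<Rightarrow> degrees Black s)" if "x \<in> set xs" for x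
    using Vertex that by (cases x) auto
  have "(\<Sum>x\<leftarrow>xs. case x of None \<Rightarrow> 0 | Some s \<Rightarrow> total_degree s) =
      (\<Sum>x\<leftarrow>xs. \<Sum>\<^sub># (case x of None \<Rightarrow> {#} | Some s \<Rightarrow> degrees White s)) +
      (\<Sum>x\<leftarrow>xs. \<Sum>\<^sub># (case x of None \<Rightarrow> {#} | Some s \<Rightarrow> degrees Black s))"
    unfolding sum_list_addf[symmetric] by (rule arg_cong[of _ _ sum_list], rule map_cong) (auto simp: *)
  then show ?case
    by (cases c) (simp_all add: sum_mset_sum_list)
qed

text \<open>At size at most \<open>Suc n\<close>, the top vertex has at most \<open>n\<close>
  entries, and each subtree among them has size at most \<open>n\<close>.\<close>

lemma finite_total_degree_le: "finite {t. total_degree t \<le> n}"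
proof (induction n)
  case 0
  have "total_degree t \<noteq> 0" for t by (cases t) simp
  then have "{t. total_degree t \<le> 0} = {}" by auto
  then show ?case by (simp only: finite.emptyI)
next
  case (Suc n)
  let ?I = "insert None (Some ` {t. total_degree t \<le> n})"
  have "{t. total_degree t \<le> Suc n} \<subseteq>
    case_prod Vertex ` ({White, Black} \<times> {xs. set xs \<subseteq> ?I \<and> length xs \<le> n})"
  proof
    fix t assume "t \<in> {t. total_degree t \<le> Suc n}"
    then obtain c xs where t: "t = Vertex c xs"
      and le: "length xs + (\<Sum>x\<leftarrow>xs. case x of None \<Rightarrow> 0 | Some s \<Rightarrow> total_degree s) \<le> n"
      by (cases t) auto
    have "x \<in> ?I" if "x \<in> set xs" for x
    proof (cases x)
      case (Some s)
      then have "total_degree s \<le> (\<Sum>x\<leftarrow>xs. case x of None \<Rightarrow> 0 | Some s \<Rightarrow> total_degree s)"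
        using that member_le_sum_list[of "total_degree s" "map (case_option 0 total_degree) xs"]
        by force
      with le Some show ?thesis by auto
    qed simp
    then have "(c, xs) \<in> {White, Black} \<times> {xs. set xs \<subseteq> ?I \<and> length xs \<le> n}"
      using le by (cases c) auto
    then show "t \<in> case_prod Vertex ` ({White, Black} \<times> {xs. set xs \<subseteq> ?I \<and> length xs \<le> n})"
      unfolding t by (rule rev_image_eqI) simp
  qed
  moreover have "finite ({White, Black} \<times> {xs. set xs \<subseteq> ?I \<and> length xs \<le> n})"
    using Suc by (intro finite_cartesian_product finite_lists_length_le) auto
  ultimately show ?case by (meson finite_imageI finite_subset)
qed

lemma finite_degree_distribution: "finite {t. degree_distribution t = d}"
proof (rule finite_subset[OF _ finite_total_degree_le])
  show "{t. degree_distribution t = d} \<subseteq> {t. total_degree t \<le> \<Sum>\<^sub># (fst d) + \<Sum>\<^sub># (snd d)}"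
    by (auto simp: degree_distribution_def total_degree_eq)
qed

lemma finite_dart_distribution: "finite {t. dart_distribution t = d}"
proof (rule finite_subset[OF _ finite_total_degree_le])
  \<comment> \<open>The extra 1 comes from the top vertex, whose root half-edge is counted by
    \<open>total_degree\<close> only.\<close>
  have "total_degree t = Suc (\<Sum>\<^sub># (dart_degrees White t) + \<Sum>\<^sub># (dart_degrees Black t))" for t
    unfolding total_degree_eq by (cases t; cases "colour t") auto
  then show "{t. dart_distribution t = d} \<subseteq> {t. total_degree t \<le> Suc (\<Sum>\<^sub># (fst d) + \<Sum>\<^sub># (snd d))}"
    by (auto simp: dart_distribution_def)
qed

lemma finite_degree_distribution_pair: "finite {st. degree_distribution_pair st = d}"
proof -
  let ?T = "{t. total_degree t \<le> \<Sum>\<^sub># (fst d) + \<Sum>\<^sub># (snd d)}"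
  have "{st. degree_distribution_pair st = d} \<subseteq> ?T \<times> ?T"
    by (auto simp: degree_distribution_pair_def total_degree_eq)
  then show ?thesis by (rule finite_subset[OF _ finite_cartesian_product[OF finite_total_degree_le finite_total_degree_le]])
qed

text \<open>The fibres partition both sides, so bijections between corresponding fibres can be
  glued.\<close>

lemma bij_betw_of_card_fibres:
  assumes "\<And>k. finite {x \<in> X. p x = k}" "\<And>k. finite {y \<in> Y. q y = k}"
    and "\<And>k. card {x \<in> X. p x = k} = card {y \<in> Y. q y = k}"
  shows "\<exists>f. bij_betw f X Y \<and> (\<forall>x\<in>X. q (f x) = p x)"
proof -
  have "\<forall>k. \<exists>f. bij_betw f {x \<in> X. p x = k} {y \<in> Y. q y = k}"
    using assms finite_same_card_bij by blast
  then obtain F where F: "\<And>k. bij_betw (F k) {x \<in> X. p x = k} {y \<in> Y. q y = k}"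
    by metis
  have mem: "F (p x) x \<in> Y \<and> q (F (p x) x) = p x" if "x \<in> X" for x
    using bij_betwE[OF F[of "p x"]] that by blast
  have "bij_betw (\<lambda>x. F (p x) x) X Y"
  proof (rule bij_betwI')
    fix x y assume xy: "x \<in> X" "y \<in> X"
    show "(F (p x) x = F (p y) y) = (x = y)"
    proof
      assume eq: "F (p x) x = F (p y) y"
      then have "p x = p y" using mem xy by metis
      then show "x = y"
        using eq xy bij_betw_imp_inj_on[OF F[of "p x"]] by (auto dest: inj_onD)
    qed auto
  next
    fix y assume "y \<in> Y"
    then have "y \<in> F (q y) ` {x \<in> X. p x = q y}"
      using bij_betw_imp_surj_on[OF F[of "q y"]] by auto
    then show "\<exists>x\<in>X. y = F (p x) x" by force
  qed (use mem in auto)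
  with mem show ?thesis by blast
qed


section \<open>Darts of trees with given total charge\<close>

lemma charge_next_dart [simp]: "charge (next_dart t) = charge t"
proof (cases t rule: next_dart.cases)
  case (2 c xs)
  then show ?thesis by (cases c) auto
qed auto

text \<open>Here \<open>charge\<close> is the total charge, because a distinguished half-edge is an
  entry of the list. The blossom condition is read with the vertex of the dart on top, so it also
  concerns the edge of the dart.\<close>

definition darts :: "int \<Rightarrow> nat multiset \<times> nat multiset \<Rightarrow> tree set" where
  "darts k d = {t. blossom_tree t \<and> charge t = k \<and> dart_distribution t = d}"

lemma finite_darts [simp]: "finite (darts k d)"
  by (rule finite_subset[OF _ finite_dart_distribution[of d]]) (auto simp: darts_def)

text \<open>A half-edge that becomes the root is no longer counted in the charge, hence
  \<open>k - 1\<close> and \<open>k + 1\<close>. Positive charge excludes a vertex with empty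
  list.\<close>

lemma dart_cases:
  assumes "t \<in> darts k d" "k > 0"
  obtains (leaf) xs where "t = Vertex White (None # xs)" "Vertex White xs \<in> W (k - 1)"
      "degree_distribution (Vertex White xs) = d"
    | (bud) xs where "t = Vertex Black (None # xs)" "Vertex Black xs \<in> B (k + 1)"
      "degree_distribution (Vertex Black xs) = d"
    | (edge) c e xs ys where "t = Vertex c (Some (Vertex e ys) # xs)"
proof (cases t rule: next_dart.cases)
  case (1 c)
  then show ?thesis using assms by (auto simp: darts_def)
next
  case (2 c xs)
  then show ?thesis using assms leaf bud
    by (cases c) (auto simp: darts_def W_def B_def)
next
  case (3 c e ys xs)
  then show ?thesis using assms edge by (auto simp: darts_def)
qed

fun root_dart :: "tree \<Rightarrow> tree" where
  "root_dart (Vertex c xs) = Vertex c (None # xs)"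

lemma inj_root_dart: "inj root_dart"
proof (rule injI)
  fix s t assume "root_dart s = root_dart t"
  then show "s = t" by (cases s; cases t) auto
qed

lemma root_dart_image_iff [simp]:
  "Vertex c (None # xs) \<in> root_dart ` X \<longleftrightarrow> Vertex c xs \<in> X"
  "Vertex c (Some s # xs) \<notin> root_dart ` X"
proof -
  show "Vertex c (None # xs) \<in> root_dart ` X \<longleftrightarrow> Vertex c xs \<in> X"
    using inj_image_mem_iff[OF inj_root_dart, of "Vertex c xs" X] by simp
  show "Vertex c (Some s # xs) \<notin> root_dart ` X"
  proof
    assume "Vertex c (Some s # xs) \<in> root_dart ` X"
    then obtain t where "Vertex c (Some s # xs) = root_dart t" by blast
    then show False by (cases t) simp
  qed
qed

lemma root_dart_in_darts:
  "t \<in> W k \<Longrightarrow> root_dart t \<in> darts (k + 1) (degree_distribution t)"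
  "t \<in> B k \<Longrightarrow> root_dart t \<in> darts (k - 1) (degree_distribution t)"
  by (cases t; auto simp: W_def B_def darts_def)+

lemma sum_root_dart:
  assumes "root_dart ` X \<subseteq> darts k d"
  shows "(\<Sum>t\<in>darts k d. of_bool (t \<in> root_dart ` X)) = int (card X)"
proof -
  have "(\<Sum>t\<in>darts k d. of_bool (t \<in> root_dart ` X)) = int (card (darts k d \<inter> root_dart ` X))"
    by (simp add: sum.If_cases of_bool_def Collect_conj_eq)
  also have "darts k d \<inter> root_dart ` X = root_dart ` X" using assms by blast
  finally show ?thesis
    using card_image[of root_dart X] inj_root_dart by (simp add: inj_on_def)
qed

lemma peak_ge_charge: "charge t \<le> peak (half_edges t)"
  by (simp add: charge_eq_excess excess_le_peak)

section \<open>Total charge 1\<close>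

text \<open>The charges of the two sides of an edge add up to 1, so the white side has charge at
  least 0 iff the black side has charge at most 1: it does not matter which side is lower. An
  injective self-map of a finite set is onto.\<close>

lemma next_dart_image_darts_1: "next_dart ` darts 1 d = darts 1 d"
proof (rule endo_inj_surj)
  show "next_dart ` darts 1 d \<subseteq> darts 1 d"
  proof
    fix u assume "u \<in> next_dart ` darts 1 d"
    then obtain t where t: "u = next_dart t" "t \<in> darts 1 d" by blast
    then show "u \<in> darts 1 d"
    proof (cases t rule: next_dart.cases)
      case (3 c e ys xs)
      then show ?thesis using t
        by (cases c; cases e) (auto simp: darts_def admissible_def degree_distribution_pair_commute)
    next
      case (2 c xs)
      then show ?thesis using t by (cases c) (auto simp: darts_def)
    qed (use t in auto)
  qed
  show "inj_on next_dart (darts 1 d)"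
    using inj_next_dart by (rule inj_on_subset) simp
qed simp

lemma card_unbalanced_W_0:
  assumes "M \<ge> 1"
  shows "card {t \<in> W 0. degree_distribution t = d \<and> peak (half_edges t) = M} =
    card {t \<in> B 2. degree_distribution t = d \<and> peak (half_edges t) = M + 1}"
    (is "card ?X = card ?Y")
proof -
  \<comment> \<open>\<open>h\<close> tests whether the peak lies above \<open>M\<close>. The peak at
    a dart counts the distinguished half-edge: passing a leaf from \<open>?X\<close> takes it from
    \<open>M + 1\<close> to \<open>M\<close>, passing a bud from \<open>?Y\<close> takes it from
    \<open>M\<close> to \<open>M + 1\<close>, and no other step changes \<open>h\<close>.\<close>
  define h :: "tree \<Rightarrow> int" where "h = (\<lambda>t. of_bool (peak (half_edges t) \<ge> M + 1))"
  have sub: "root_dart ` ?X \<subseteq> darts 1 d" "root_dart ` ?Y \<subseteq> darts 1 d"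
    using root_dart_in_darts[of _ 0] root_dart_in_darts[of _ 2] by auto
  have "h (next_dart t) - h t = of_bool (t \<in> root_dart ` ?Y) - of_bool (t \<in> root_dart ` ?X)"
    if "t \<in> darts 1 d" for t
    using that zero_less_one
  proof (cases rule: dart_cases)
    case (leaf xs)
    then show ?thesis using assms
      by (auto simp: h_def peak_append W_def B_def max_def charge_eq_excess)
  next
    case (bud xs)
    then show ?thesis using assms peak_ge_charge[of "Vertex Black xs"]
      by (auto simp: h_def peak_append W_def B_def max_def charge_eq_excess)
  next
    case (edge c e xs ys)
    then show ?thesis by (simp add: h_def)
  qed
  then have "(\<Sum>t\<in>darts 1 d. h (next_dart t) - h t) = int (card ?Y) - int (card ?X)"
    by (simp add: sum_subtractf sum_root_dart[OF sub(1)] sum_root_dart[OF sub(2)])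
  moreover have "(\<Sum>t\<in>darts 1 d. h (next_dart t)) = (\<Sum>t\<in>darts 1 d. h t)"
    using sum.reindex[OF inj_on_subset[OF inj_next_dart subset_UNIV[of "darts 1 d"]], of h]
    by (simp add: next_dart_image_darts_1)
  ultimately show ?thesis by (simp add: sum_subtractf)
qed

lemma W_star_iff: "W_star k = {t \<in> W k. peak (half_edges t) \<le> k}"
  by (auto simp: W_star_def W_def balanced_iff_peak)

text \<open>The peak is tracked along with the degrees because the case of total charge 2 compares
  peaks through \<open>\<psi>\<close>.\<close>

lemma unbalanced_W_0_bij:
  obtains \<psi> where "bij_betw \<psi> (W 0 - W_star 0) (B 2)"
    "\<And>t. t \<in> W 0 - W_star 0 \<Longrightarrow> degree_distribution (\<psi> t) = degree_distribution t"
    "\<And>t. t \<in> W 0 - W_star 0 \<Longrightarrow> peak (half_edges (\<psi> t)) = peak (half_edges t) + 1"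
proof -
  let ?p = "\<lambda>t. (degree_distribution t, peak (half_edges t) + 1)"
  let ?q = "\<lambda>t. (degree_distribution t, peak (half_edges t))"
  have "\<exists>f. bij_betw f (W 0 - W_star 0) (B 2) \<and> (\<forall>x\<in>W 0 - W_star 0. ?q (f x) = ?p x)"
  proof (rule bij_betw_of_card_fibres)
    fix k :: "(nat multiset \<times> nat multiset) \<times> int"
    obtain d m where k: "k = (d, m)" by (cases k)
    show "finite {x \<in> W 0 - W_star 0. ?p x = k}" "finite {y \<in> B 2. ?q y = k}"
      by (rule finite_subset[OF _ finite_degree_distribution[of d]], force simp: k)+
    show "card {x \<in> W 0 - W_star 0. ?p x = k} = card {y \<in> B 2. ?q y = k}"
    \<comment> \<open>Unbalanced trees in \<open>W 0\<close> have peak at least 1 and trees in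
      \<open>B 2\<close> have peak at least 2, so both fibres are empty for smaller
      \<open>m\<close>.\<close>
    proof (cases "m \<ge> 2")
      case True
      have "{x \<in> W 0 - W_star 0. ?p x = k} =
          {t \<in> W 0. degree_distribution t = d \<and> peak (half_edges t) = m - 1}"
        using True by (auto simp: k W_star_iff)
      moreover have "{y \<in> B 2. ?q y = k} =
          {t \<in> B 2. degree_distribution t = d \<and> peak (half_edges t) = m - 1 + 1}"
        by (auto simp: k)
      ultimately show ?thesis using card_unbalanced_W_0[of "m - 1" d] True by simp
    next
      case False
      then have "{x \<in> W 0 - W_star 0. ?p x = k} = {}"
        by (auto simp: k W_star_iff)
      moreover have "{y \<in> B 2. ?q y = k} = {}"
      proof -
        have "peak (half_edges y) \<ge> 2" if "y \<in> B 2" for y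
          using that peak_ge_charge[of y] by (simp add: B_def)
        with False show ?thesis by (auto simp: k)
      qed
      ultimately show ?thesis by (simp only:)
    qed
  qed
  then show thesis using that by auto
qed

section \<open>Total charge 2\<close>

text \<open>Joins the two roots to an edge; the distinguished dart is the one reached by crossing
  this edge from \<open>t\<close> to \<open>s\<close> in \<open>attach s t\<close>.\<close>

fun attach :: "tree \<Rightarrow> tree \<Rightarrow> tree" where
  "attach (Vertex c xs) s = Vertex c (xs @ [Some s])"

lemma attach_eq_iff [simp]: "attach s t = attach s' t' \<longleftrightarrow> s = s' \<and> t = t'"
  by (cases s; cases s') auto

lemma half_edges_attach [simp]: "half_edges (attach s t) = half_edges s @ half_edges t"
  by (cases s) simp

text \<open>When the charges of the two sides add up to 2, this is the only split for which the
  blossom condition depends on the side that is lower: \<open>t\<close> is admissible,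
  \<open>s\<close> is not.\<close>

definition critical_pairs :: "nat multiset \<times> nat multiset \<Rightarrow> (tree \<times> tree) set" where
  "critical_pairs d = {(s, t). s \<in> B 2 \<and> t \<in> W 0 \<and> degree_distribution_pair (s, t) = d}"

text \<open>For total charge 2, passing to the next dart destroys or creates the blossom condition exactly
  when it crosses an edge that splits the tree into an element of \<open>B 2\<close> and one of \<open>W 0\<close>.\<close>

lemma darts_2_entered:
  "next_dart ` darts 2 d - darts 2 d = (\<lambda>(s, t). attach t s) ` critical_pairs d"
proof (intro equalityI subsetI)
  fix u assume u: "u \<in> next_dart ` darts 2 d - darts 2 d"
  then obtain t where t: "u = next_dart t" "t \<in> darts 2 d" by blast
  show "u \<in> (\<lambda>(s, t). attach t s) ` critical_pairs d"
  proof (cases t rule: next_dart.cases)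
    case (1 c)
    then show ?thesis using t by (auto simp: darts_def)
  next
    case (2 c xs)
    then show ?thesis using t u by (cases c) (auto simp: darts_def)
  next
    case (3 c e ys xs)
    then have "c = Black \<and> e = White \<and> (Vertex c xs, Vertex e ys) \<in> critical_pairs d"
      using t u by (cases c; cases e)
        (auto simp: darts_def admissible_def critical_pairs_def B_def W_def degree_distribution_pair_commute)
    moreover have "u = attach (Vertex e ys) (Vertex c xs)" using t 3 by simp
    ultimately show ?thesis by force
  qed
next
  fix u assume "u \<in> (\<lambda>(s, t). attach t s) ` critical_pairs d"
  then obtain s t where u: "u = attach t s" and st: "(s, t) \<in> critical_pairs d" by auto
  obtain xs ys where "s = Vertex Black xs" "t = Vertex White ys"
    using st by (cases s; cases t) (auto simp: critical_pairs_def B_def W_def)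
  \<comment> \<open>Before the crossing the lower subtree is \<open>t\<close>; after it, it is
    \<open>s\<close>, black of charge 2.\<close>
  then have "Vertex Black (Some t # xs) \<in> darts 2 d" "u = next_dart (Vertex Black (Some t # xs))"
    "u \<notin> darts 2 d"
    using st u by (auto simp: darts_def critical_pairs_def B_def W_def admissible_def
        degree_distribution_pair_commute)
  then show "u \<in> next_dart ` darts 2 d - darts 2 d" by blast
qed

text \<open>In the opposite crossing the lower subtree changes from the inadmissible
  \<open>s\<close> to the admissible \<open>t\<close>. So the preceding dart is outside
  \<open>darts 2 d\<close>, and by injectivity there is no other preimage.\<close>

lemma darts_2_left:
  "darts 2 d - next_dart ` darts 2 d = (\<lambda>(s, t). attach s t) ` critical_pairs d"
proof (intro equalityI subsetI)
  fix u assume u: "u \<in> darts 2 d - next_dart ` darts 2 d"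
  obtain c xs where c: "u = Vertex c xs" by (cases u)
  with u have "xs \<noteq> []" by (auto simp: darts_def)
  then obtain ys y where ys: "xs = ys @ [y]" by (metis rev_exhaust)
  show "u \<in> (\<lambda>(s, t). attach s t) ` critical_pairs d"
  proof (cases y)
    case None
    then have "Vertex c (None # ys) \<in> darts 2 d" "u = next_dart (Vertex c (None # ys))"
      using u c ys by (cases c; auto simp: darts_def)+
    with u show ?thesis by blast
  next
    case (Some t)
    obtain e zs where t: "t = Vertex e zs" by (cases t)
    have "u = next_dart (Vertex e (Some (Vertex c ys) # zs))"
      using c ys Some t by simp
    with u have "Vertex e (Some (Vertex c ys) # zs) \<notin> darts 2 d" by blast
    then have "(Vertex c ys, t) \<in> critical_pairs d"
      using u c ys Some t by (cases c; cases e)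
        (auto simp: darts_def admissible_def critical_pairs_def B_def W_def degree_distribution_pair_commute)
    moreover have "u = attach (Vertex c ys) t" using c ys Some by simp
    ultimately show ?thesis by force
  qed
next
  fix u assume "u \<in> (\<lambda>(s, t). attach s t) ` critical_pairs d"
  then obtain s t where u: "u = attach s t" and st: "(s, t) \<in> critical_pairs d" by auto
  obtain xs ys where s: "s = Vertex Black xs" and t: "t = Vertex White ys"
    using st by (cases s; cases t) (auto simp: critical_pairs_def B_def W_def)
  have "u \<in> darts 2 d"
    using st u s t by (auto simp: darts_def critical_pairs_def B_def W_def admissible_def)
  moreover have "u \<notin> next_dart ` darts 2 d"
  proof
    assume "u \<in> next_dart ` darts 2 d"
    moreover have "u = next_dart (Vertex White (Some s # ys))" using u s t by simp
    ultimately have "Vertex White (Some s # ys) \<in> darts 2 d"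
      by (metis inj_image_mem_iff inj_next_dart)
    then show False using st s by (auto simp: darts_def admissible_def critical_pairs_def B_def)
  qed
  ultimately show "u \<in> darts 2 d - next_dart ` darts 2 d" by blast
qed

lemma sum_telescope_image:
  fixes h :: "'a \<Rightarrow> int"
  assumes "finite A" "inj f"
  shows "(\<Sum>x\<in>A. h x - h (f x)) = sum h (A - f ` A) - sum h (f ` A - A)"
proof -
  have "(\<Sum>x\<in>A. h (f x)) = sum h (f ` A)"
    using assms(2) by (simp add: sum.reindex inj_on_subset)
  moreover have "sum h A = sum h (A - f ` A) + sum h (A \<inter> f ` A)"
    "sum h (f ` A) = sum h (f ` A - A) + sum h (A \<inter> f ` A)"
    using assms(1) by (simp_all add: sum.Int_Diff[of A h "f ` A"] sum.Int_Diff[of "f ` A" h A] Int_commute)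
  ultimately show ?thesis by (simp add: sum_subtractf)
qed

lemma finite_critical_pairs [simp]: "finite (critical_pairs d)"
  by (rule finite_subset[OF _ finite_degree_distribution_pair[of d]]) (auto simp: critical_pairs_def)

lemma card_unbalanced_W_1_eq_sum:
  "int (card {t \<in> W 1 - W_star 1. degree_distribution t = d}) - int (card {t \<in> B 3. degree_distribution t = d}) =
    (\<Sum>(s, t)\<in>critical_pairs d. peak (half_edges s @ half_edges t) - peak (half_edges t @ half_edges s))"
    (is "int (card ?X) - int (card ?Y) = _")
proof -
  define h where "h = (\<lambda>t. peak (half_edges t))"
  have sub: "root_dart ` ?X \<subseteq> darts 2 d" "root_dart ` ?Y \<subseteq> darts 2 d"
    using root_dart_in_darts[of _ 1] root_dart_in_darts[of _ 3] by auto
  \<comment> \<open>If \<open>p\<close> is the peak of the remaining half-edges, a leaf changes the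
    peak from \<open>p + 1\<close> to \<open>max p 2\<close>, a decrease exactly for
    \<open>p > 1\<close>. A bud changes it from \<open>p - 1\<close> to \<open>p\<close>, since
    \<open>p \<ge> 3\<close>.\<close>
  have "h t - h (next_dart t) = of_bool (t \<in> root_dart ` ?X) - of_bool (t \<in> root_dart ` ?Y)"
    if "t \<in> darts 2 d" for t
    using that zero_less_numeral
  proof (cases rule: dart_cases)
    case (leaf xs)
    then show ?thesis using peak_ge_charge[of "Vertex White xs"]
      by (auto simp: h_def peak_append W_star_iff W_def B_def max_def charge_eq_excess)
  next
    case (bud xs)
    then show ?thesis using peak_ge_charge[of "Vertex Black xs"]
      by (auto simp: h_def peak_append W_def B_def max_def charge_eq_excess)
  next
    case (edge c e xs ys)
    then show ?thesis by (simp add: h_def)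
  qed
  then have "int (card ?X) - int (card ?Y) = (\<Sum>t\<in>darts 2 d. h t - h (next_dart t))"
    by (simp add: sum_subtractf sum_root_dart[OF sub(1)] sum_root_dart[OF sub(2)] del: Diff_iff)
  also have "\<dots> = sum h (darts 2 d - next_dart ` darts 2 d) - sum h (next_dart ` darts 2 d - darts 2 d)"
    by (rule sum_telescope_image) (auto intro: inj_next_dart)
  also have "sum h (darts 2 d - next_dart ` darts 2 d) =
      (\<Sum>(s, t)\<in>critical_pairs d. peak (half_edges s @ half_edges t))"
    unfolding darts_2_left by (subst sum.reindex) (auto simp: inj_on_def h_def intro!: sum.cong)
  also have "sum h (next_dart ` darts 2 d - darts 2 d) =
      (\<Sum>(s, t)\<in>critical_pairs d. peak (half_edges t @ half_edges s))"
    unfolding darts_2_entered by (subst sum.reindex) (auto simp: inj_on_def h_def intro!: sum.cong)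
  finally show ?thesis by (simp add: sum_subtractf case_prod_unfold)
qed

lemma card_unbalanced_W_1:
  "card {t \<in> W 1 - W_star 1. degree_distribution t = d} =
    card {t \<in> B 3. degree_distribution t = d} + card {p \<in> B 2 \<times> B 2. degree_distribution_pair p = d}"
proof -
  obtain \<psi> where \<psi>: "bij_betw \<psi> (W 0 - W_star 0) (B 2)"
    "\<And>t. t \<in> W 0 - W_star 0 \<Longrightarrow> degree_distribution (\<psi> t) = degree_distribution t"
    "\<And>t. t \<in> W 0 - W_star 0 \<Longrightarrow> peak (half_edges (\<psi> t)) = peak (half_edges t) + 1"
    using unbalanced_W_0_bij by blast
  define \<delta> :: "int \<Rightarrow> int \<Rightarrow> int" where "\<delta> = (\<lambda>a b. if a < b then 2 else if a = b then 1 else 0)"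
  define h where "h = (\<lambda>t. peak (half_edges t))"
  let ?g = "\<lambda>(s, t). peak (half_edges s @ half_edges t) - peak (half_edges t @ half_edges s)"
  let ?C = "{(s, t) \<in> critical_pairs d. t \<notin> W_star 0}"
  let ?D = "{p \<in> B 2 \<times> B 2. degree_distribution_pair p = d}"
  have fin: "finite ?D"
    by (rule finite_subset[OF _ finite_degree_distribution_pair[of d]]) auto
  \<comment> \<open>With peaks \<open>p\<close> of \<open>s\<close> and \<open>q\<close> of
    \<open>t\<close>, and excesses 2 and 0, the difference is
    \<open>max p (q + 2) - max p q\<close>. It vanishes for \<open>q = 0\<close> because
    \<open>p \<ge> 2\<close>; for \<open>q \<ge> 1\<close> it is \<open>\<delta> p (q + 1)\<close>,
    and \<open>q + 1\<close> is the peak of \<open>\<psi> t\<close>.\<close>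
  have g: "?g (s, t) = (if t \<in> W_star 0 then 0 else \<delta> (h s) (h (\<psi> t)))"
    if "(s, t) \<in> critical_pairs d" for s t
  proof -
    have "s \<in> B 2" "t \<in> W 0" using that by (auto simp: critical_pairs_def)
    then show ?thesis
      using \<psi>(3)[of t] peak_ge_charge[of s] peak_nonneg[of "half_edges t"]
      by (auto simp: peak_append B_def W_def charge_eq_excess \<delta>_def h_def max_def W_star_iff)
  qed
  have "sum ?g (critical_pairs d) = sum ?g ?C"
    by (rule sum.mono_neutral_right) (use g in auto)
  also have "\<dots> = (\<Sum>p\<in>?C. (\<lambda>(s, t). \<delta> (h s) (h t)) (map_prod id \<psi> p))"
    by (rule sum.cong) (use g in auto)
  also have "\<dots> = (\<Sum>(s, t)\<in>?D. \<delta> (h s) (h t))"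
  proof (rule sum.reindex_bij_betw)
    have inj: "inj_on (map_prod id \<psi>) ?C"
      using bij_betw_imp_inj_on[OF \<psi>(1)] by (auto simp: inj_on_def critical_pairs_def)
    have "map_prod id \<psi> ` ?C = ?D"
    proof (intro equalityI subsetI)
      fix p assume "p \<in> map_prod id \<psi> ` ?C"
      then obtain s t where "p = (s, \<psi> t)" "s \<in> B 2" "t \<in> W 0 - W_star 0"
        "degree_distribution_pair (s, t) = d"
        by (auto simp: critical_pairs_def)
      then show "p \<in> ?D"
        using bij_betwE[OF \<psi>(1)] \<psi>(2) degree_distribution_pair_cong[of s s "\<psi> t" t] by auto
    next
      fix p assume p: "p \<in> ?D"
      then obtain s t' where p': "p = (s, t')" "s \<in> B 2" "t' \<in> B 2" by auto
      then obtain t where t: "t' = \<psi> t" "t \<in> W 0 - W_star 0"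
        using bij_betw_imp_surj_on[OF \<psi>(1)] by blast
      then have "(s, t) \<in> ?C"
        using p p' \<psi>(2) degree_distribution_pair_cong[of s s "\<psi> t" t] by (auto simp: critical_pairs_def)
      then show "p \<in> map_prod id \<psi> ` ?C"
        unfolding p' t by (rule rev_image_eqI) simp
    qed
    with inj show "bij_betw (map_prod id \<psi>) ?C ?D" by (simp add: bij_betw_def)
  qed
  also have "\<dots> = int (card ?D)"
  proof -
    have swap: "(\<Sum>(s, t)\<in>?D. \<delta> (h s) (h t)) = (\<Sum>(s, t)\<in>?D. \<delta> (h t) (h s))"
      by (rule sum.reindex_bij_witness[of _ prod.swap prod.swap])
        (auto simp: degree_distribution_pair_commute)
    \<comment> \<open>\<open>\<delta> a b + \<delta> b a = 2\<close> holds in each of the three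
      cases.\<close>
    have "(\<Sum>(s, t)\<in>?D. \<delta> (h s) (h t)) + (\<Sum>(s, t)\<in>?D. \<delta> (h t) (h s)) = (\<Sum>p\<in>?D. 2)"
      unfolding sum.distrib[symmetric] by (rule sum.cong) (auto simp: \<delta>_def)
    with swap show ?thesis by simp
  qed
  finally show ?thesis using card_unbalanced_W_1_eq_sum[of d] by linarith
qed

section \<open>Assembling the bijections from the fibre counts\<close>

lemma Collect_Plus_case_sum:
  "{y \<in> X <+> Y. case_sum p q y = k} = {x \<in> X. p x = k} <+> {y \<in> Y. q y = k}"
  by (auto simp: Plus_def)

lemma finite_fibre [simp]:
  "finite {t \<in> X. degree_distribution t = d}"
  "finite {p \<in> Y. degree_distribution_pair p = d}"
  by (rule finite_subset[OF _ finite_degree_distribution[of d]], blast)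
    (rule finite_subset[OF _ finite_degree_distribution_pair[of d]], blast)

lemma card_W_split:
  "card {t \<in> W k. degree_distribution t = d} =
    card {t \<in> W_star k. degree_distribution t = d} + card {t \<in> W k - W_star k. degree_distribution t = d}"
proof -
  have eq: "{t \<in> W k. degree_distribution t = d} =
    {t \<in> W_star k. degree_distribution t = d} \<union> {t \<in> W k - W_star k. degree_distribution t = d}"
    by (auto simp: W_star_def)
  show ?thesis
    unfolding eq by (rule card_Un_disjoint[OF finite_fibre(1) finite_fibre(1)]) auto
qed

theorem theorem12:
  "(\<exists>f. bij_betw f (W 0) (W_star 0 <+> B 2) \<and>
      (\<forall>t\<in>W 0. case_sum degree_distribution degree_distribution (f t)
                = degree_distribution t)) \<and>
   (\<exists>g. bij_betw g (W 1) (W_star 1 <+> (B 3 <+> B 2 \<times> B 2)) \<and>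
      (\<forall>t\<in>W 1. case_sum degree_distribution
                  (case_sum degree_distribution degree_distribution_pair) (g t)
                = degree_distribution t))"
proof
  obtain \<psi> where \<psi>: "bij_betw \<psi> (W 0 - W_star 0) (B 2)"
    "\<And>t. t \<in> W 0 - W_star 0 \<Longrightarrow> degree_distribution (\<psi> t) = degree_distribution t"
    using unbalanced_W_0_bij by blast
  have "card {t \<in> W 0 - W_star 0. degree_distribution t = d} = card {t \<in> B 2. degree_distribution t = d}" for d
  proof (rule bij_betw_same_card)
    show "bij_betw \<psi> {t \<in> W 0 - W_star 0. degree_distribution t = d} {t \<in> B 2. degree_distribution t = d}"
    proof (rule bij_betw_subset[OF \<psi>(1)])
      show "\<psi> ` {t \<in> W 0 - W_star 0. degree_distribution t = d} = {t \<in> B 2. degree_distribution t = d}"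
        unfolding bij_betw_imp_surj_on[OF \<psi>(1), symmetric] using \<psi>(2) by auto
    qed auto
  qed
  \<comment> \<open>Balanced trees contribute the same number to both sides of each fibre, which
    leaves the count of unbalanced ones.\<close>
  then show "\<exists>f. bij_betw f (W 0) (W_star 0 <+> B 2) \<and>
      (\<forall>t\<in>W 0. case_sum degree_distribution degree_distribution (f t) = degree_distribution t)"
    by (intro bij_betw_of_card_fibres) (simp_all add: Collect_Plus_case_sum card_Plus card_W_split del: Diff_iff)
  show "\<exists>g. bij_betw g (W 1) (W_star 1 <+> (B 3 <+> B 2 \<times> B 2)) \<and>
      (\<forall>t\<in>W 1. case_sum degree_distribution
                  (case_sum degree_distribution degree_distribution_pair) (g t)
                = degree_distribution t)"
    by (intro bij_betw_of_card_fibres)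
      (simp_all add: Collect_Plus_case_sum card_Plus card_W_split card_unbalanced_W_1 del: Diff_iff)
qed

end
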